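(* Let $\{\mathbf{x}^{(k)}\}$ be a sequence generated by any one of the following three algorithms (described in the context) applied to the problem $\min_{\mathbf{x}\in\mathcal{X}}E(\mathbf{x})$: block coordinate descent (BCD), projected gradient descent (PGD) with line-search, or the Frank-Wolfe algorithm (FW) with line-search. Then every limit point $\mathbf{x}^*$ of $\{\mathbf{x}^{(k)}\}$ is a stationary point of $\min_{\mathbf{x}\in\mathcal{X}}E(\mathbf{x})$, i.e. $\mathbf{x}^*\in\mathcal{X}$ and $\nabla E(\mathbf{x}^* )^\top(\mathbf{x}-\mathbf{x}^* )\ge 0$ for all $\mathbf{x}\in\mathcal{X}$.
   Context: Let $\mathcal{V}=\{1,\dots,n\}$ be a finite set of nodes; each node $i$ has a finite nonempty set of labels $\mathcal{S}_i$. Let $\mathcal{C}$ be a finite set of cliques; each clique is an ordered tuple $C=(i_1,\dots,i_\alpha)$ of distinct nodes, and the single nodes are among the cliques. For each $C\in\mathcal{C}$ let $\mathcal{S}_C=\prod_{i\in C}\mathcal{S}_i$ and let $f_C:\mathcal{S}_C\to\mathbb{R}$ be a real-valued potential function. A vector $\mathbf{x}=(\mathbf{x}_1,\dots,\mathbf{x}_n)$ consists of blocks $\mathbf{x}_i=(x_i(s))_{s\in\mathcal{S}_i}\in\mathbb{R}^{|\mathcal{S}_i|}$. The energy is $$E(\mathbf{x})=\sum_{C\in\mathcal{C}}\ \sum_{s_C\in\mathcal{S}_C} f_C(s_C)\prod_{j\in C}x_j(s_j),$$ where $s_j$ denotes the component of $s_C$ at node $j$, and $\mathcal{X}=\{\mathbf{x}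 : \mathbf{1}^\top\mathbf{x}_i=1,\ \mathbf{x}_i\ge\mathbf{0}\ \forall i\in\mathcal{V}\}.$ A limit point of a sequence is the limit of some convergent subsequence. All three algorithms start from some $\mathbf{x}^{(0)}\in\mathcal{X}$. BCD: in outer iteration $k$, for $i=1,2,\dots,n$ in this order, consider the block problem $\min_{\mathbf{1}^\top\mathbf{x}_i=1,\ \mathbf{x}_i\ge\mathbf{0}} E(\mathbf{x}_1^{(k+1)},\dots,\mathbf{x}_{i-1}^{(k+1)},\mathbf{x}_i,\mathbf{x}_{i+1}^{(k)},\dots,\mathbf{x}_n^{(k)})$, whose objective is affine in $\mathbf{x}_i$ and which therefore always has a discrete optimal solution (one with all entries in $\{0,1\}$). If $\mathbf{x}_i^{(k)}$ is itself a discrete optimal solution, set $\mathbf{x}_i^{(k+1)}=\mathbf{x}_i^{(k)}$; otherwise let $\mathbf{x}_i^{(k+1)}$ be any discrete optimal solution. Repeat with $k$ increased by one until $\mathbf{x}^{(k+1)}=\mathbf{x}^{(k)}$; once this happens the algorithm stops, and the sequence is regarded as constant from then on. PGD with line-search: at iteration $k$, compute $\mathbf{s}^{(k)}=\operatorname{argmin}_{\mathbf{s}\in\mathcal{X}}\|\mathbf{x}^{(k)}-\beta^{(k)}\nabla E(\mathbf{x}^{(k)})-\mathbf{s}\|_2^2$ with $\beta^{(k)}=1$, and set $\mathbf{x}^{(k+1)}=\mathbf{x}^{(k)}+\alpha^{(k)}(\mathbf{s}^{(k)}-\mathbf{x}^{(k)})$. FW with line-search: at iteration $k$, choose $\mathbf{s}^{(k)}\in\operatorname{argmin}_{\mathbf{s}\in\mathcal{X}}\mathbf{s}^\top\nabla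 E(\mathbf{x}^{(k)})$, and set $\mathbf{x}^{(k+1)}=\mathbf{x}^{(k)}+\alpha^{(k)}(\mathbf{s}^{(k)}-\mathbf{x}^{(k)})$. In both PGD and FW the line-search step-size is a minimizer $\alpha^{(k)}\in\operatorname{argmin}_{0\le\alpha\le1}E\big(\mathbf{x}^{(k)}+\alpha(\mathbf{s}^{(k)}-\mathbf{x}^{(k)})\big)$. *)

theory Defs
  imports "HOL-Analysis.Analysis"
begin

text \<open>
  The nodes are the elements of a finite linearly ordered type \<open>'n\<close> (the set \<open>{1..n}\<close> with its
  order), and \<open>S i\<close> is the label set of node \<open>i\<close>, a subset of a common finite type \<open>'l\<close> of labels.
  The label sets of different nodes may differ, also in size.
  A point \<open>x\<close> with \<open>x $ i $ s = x\<^sub>i(s)\<close> lives in \<open>real ^ 'l ^ 'n\<close>; coordinates with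
  \<open>s \<notin> S i\<close> are padding: the energy does not depend on them, and they vanish on the feasible set.
  Norm and inner product of \<open>real ^ 'l ^ 'n\<close> are the Euclidean ones.
  A clique is a list of nodes, and a labelling of it is the list of the labels at its positions.
\<close>

definition energy ::
  "('n \<Rightarrow> 'l set) \<Rightarrow> 'n list set \<Rightarrow> ('n list \<Rightarrow> 'l list \<Rightarrow> real) \<Rightarrow> real ^ 'l ^ 'n \<Rightarrow> real" where
  "energy S \<C> f x =
     (\<Sum>C\<in>\<C>. \<Sum>s\<in>listset (map S C). f C s * (\<Prod>j<length C. x $ (C ! j) $ (s ! j)))"

definition label_simplex :: "'l set \<Rightarrow> (real ^ 'l) set" where
  "label_simplex L =
     {v. (\<Sum>s\<in>L. v $ s) = 1 \<and> (\<forall>s\<in>L. 0 \<le> v $ s) \<and> (\<forall>s. s \<notin> L \<longrightarrow> v $ s = 0)}"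

definition feasible :: "('n \<Rightarrow> 'l set) \<Rightarrow> (real ^ 'l ^ 'n) set" where
  "feasible S = {x. \<forall>i. x $ i \<in> label_simplex (S i)}"

definition gradient :: "('a::euclidean_space \<Rightarrow> real) \<Rightarrow> 'a \<Rightarrow> 'a" where
  "gradient E x = (THE g. GDERIV E x :> g)"

definition stationary_point :: "('a::euclidean_space \<Rightarrow> real) \<Rightarrow> 'a set \<Rightarrow> 'a \<Rightarrow> bool" where
  "stationary_point E X x \<longleftrightarrow> x \<in> X \<and> (\<forall>z\<in>X. gradient E x \<bullet> (z - x) \<ge> 0)"

definition set_block :: "'b ^ 'n \<Rightarrow> 'n \<Rightarrow> 'b \<Rightarrow> 'b ^ 'n" where
  "set_block x i v = (\<chi> j. if j = i then v else x $ j)"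

definition discrete_block_solution ::
  "('n \<Rightarrow> 'l set) \<Rightarrow> (real ^ 'l ^ 'n \<Rightarrow> real) \<Rightarrow> real ^ 'l ^ 'n \<Rightarrow> 'n \<Rightarrow> real ^ 'l \<Rightarrow> bool" where
  "discrete_block_solution S E x i v \<longleftrightarrow>
     is_arg_min (\<lambda>w. E (set_block x i w)) (\<lambda>w. w \<in> label_simplex (S i)) v \<and>
     (\<forall>s. v $ s \<in> {0, 1})"

text \<open>
  One outer iteration from \<open>x\<close> to \<open>x'\<close>. When block \<open>i\<close> is treated, the blocks before \<open>i\<close> already
  have their new values.
\<close>

definition bcd_sweep ::
  "('n::{finite,linorder} \<Rightarrow> 'l set) \<Rightarrow> (real ^ 'l ^ ('n::{finite,linorder}) \<Rightarrow> real) \<Rightarrow>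
     real ^ 'l ^ ('n::{finite,linorder}) \<Rightarrow> real ^ 'l ^ ('n::{finite,linorder}) \<Rightarrow> bool" where
  "bcd_sweep S E x x' \<longleftrightarrow>
     (\<forall>i. let y = (\<chi> j. if j < i then x' $ j else x $ j) in
        if discrete_block_solution S E y i (x $ i) then x' $ i = x $ i
        else discrete_block_solution S E y i (x' $ i))"

definition bcd_sequence ::
  "('n::{finite,linorder} \<Rightarrow> 'l set) \<Rightarrow> (real ^ 'l ^ ('n::{finite,linorder}) \<Rightarrow> real) \<Rightarrow>
     (nat \<Rightarrow> real ^ 'l ^ ('n::{finite,linorder})) \<Rightarrow> bool" where
  "bcd_sequence S E x \<longleftrightarrow>
     x 0 \<in> feasible S \<and>
     (\<forall>k. if \<exists>j<k. x (Suc j) = x j then x (Suc k) = x k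
          else bcd_sweep S E (x k) (x (Suc k)))"

definition line_search_step ::
  "('a::euclidean_space \<Rightarrow> real) \<Rightarrow> 'a \<Rightarrow> 'a \<Rightarrow> 'a \<Rightarrow> bool" where
  "line_search_step E x s x' \<longleftrightarrow>
     (\<exists>\<alpha>. is_arg_min (\<lambda>a. E (x + a *\<^sub>R (s - x))) (\<lambda>a. 0 \<le> a \<and> a \<le> 1) \<alpha> \<and>
          x' = x + \<alpha> *\<^sub>R (s - x))"

definition pgd_sequence ::
  "(nat \<Rightarrow> real) \<Rightarrow> ('a::euclidean_space \<Rightarrow> real) \<Rightarrow> 'a set \<Rightarrow> (nat \<Rightarrow> 'a) \<Rightarrow> bool" where
  "pgd_sequence \<beta> E X x \<longleftrightarrow>
     x 0 \<in> X \<and>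
     (\<forall>k. \<exists>s. is_arg_min (\<lambda>z. (norm (x k - \<beta> k *\<^sub>R gradient E (x k) - z))\<^sup>2) (\<lambda>z. z \<in> X) s \<and>
              line_search_step E (x k) s (x (Suc k)))"

definition fw_sequence ::
  "('a::euclidean_space \<Rightarrow> real) \<Rightarrow> 'a set \<Rightarrow> (nat \<Rightarrow> 'a) \<Rightarrow> bool" where
  "fw_sequence E X x \<longleftrightarrow>
     x 0 \<in> X \<and>
     (\<forall>k. \<exists>s. is_arg_min (\<lambda>z. z \<bullet> gradient E (x k)) (\<lambda>z. z \<in> X) s \<and>
              line_search_step E (x k) s (x (Suc k)))"

lemma GDERIV_unique:
  assumes "GDERIV E x :> g" "GDERIV E x :> g'"
  shows "g = g'"
proof -
  have "(\<lambda>h. h \<bullet> g) = (\<lambda>h. h \<bullet> g')"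
    using assms unfolding gderiv_def by (rule has_derivative_unique)
  then show ?thesis
    by (metis inner_commute vector_eq_ldot)
qed

lemma GDERIV_gradient:
  fixes E :: "'a::euclidean_space \<Rightarrow> real"
  assumes "E differentiable (at x)"
  shows "GDERIV E x :> gradient E x"
proof -
  obtain E' where E': "(E has_derivative E') (at x)"
    using assms unfolding differentiable_def by blast
  then have lin: "linear E'"
    by (rule has_derivative_linear)
  have "E' = (\<lambda>h. h \<bullet> adjoint E' 1)"
    using adjoint_works[OF lin, of _ 1] by (auto simp: fun_eq_iff)
  with E' have "GDERIV E x :> adjoint E' 1"
    unfolding gderiv_def by simp
  then show ?thesis
    unfolding gradient_def by (rule theI) (rule GDERIV_unique[OF _ \<open>GDERIV E x :> adjoint E' 1\<close>])
qed

lemma energy_differentiable: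
  fixes x :: "real ^ ('l::finite) ^ ('n::finite)"
  shows "energy S \<C> f differentiable (at x)"
proof -
  have coord: "((\<lambda>x::real ^ 'l ^ 'n. x $ i $ s) has_derivative (\<lambda>h. h $ i $ s)) (at x)" for i s
    by (intro bounded_linear.has_derivative[OF bounded_linear_vec_nth] has_derivative_ident)
  define F where "F C s x = f C s * (\<Prod>j<length C. x $ (C ! j) $ (s ! j))"
    for C s and x :: "real ^ 'l ^ 'n"
  have "\<exists>D. (F C s has_derivative D) (at x)" for C s
    unfolding F_def[abs_def]
    by (rule exI, rule has_derivative_mult_right, rule has_derivative_prod, rule coord)
  then obtain D where "\<And>C s. (F C s has_derivative D C s) (at x)"
    by metis
  then have "(energy S \<C> f has_derivative
      (\<lambda>h. \<Sum>C\<in>\<C>. \<Sum>s\<in>listset (map S C). D C s h)) (at x)"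
    unfolding energy_def[abs_def] F_def[symmetric] by (intro has_derivative_sum)
  then show ?thesis
    unfolding differentiable_def by blast
qed

end

theory Submission
  imports Defs
begin

text \<open>
  Line search: along a convergent subsequence whose targets \<open>s\<^sup>(\<^sup>k\<^sup>)\<close> converge to \<open>s\<close> as well,
  monotonicity of the energy forces \<open>E(x\<^sup>*) \<le> E(x\<^sup>* + a(s - x\<^sup>*))\<close> for all \<open>a \<in> [0,1]\<close>, so that
  \<open>\<nabla>E(x\<^sup>*) \<bullet> (s - x\<^sup>*) \<ge> 0\<close>. By continuity of the gradient, \<open>s\<close> is again a Frank-Wolfe target,
  respectively the projection target, of \<open>x\<^sup>*\<close>, and stationarity follows.
  BCD: after the first sweep the iterates are discrete, and each sweep that changes something strictly
  decreases the energy, so the sequence becomes constant at a blockwise minimizer. Its one-sided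
  directional derivatives along single blocks are nonnegative, and they add up to
  \<open>\<nabla>E(x\<^sup>*) \<bullet> (z - x\<^sup>*)\<close>.
\<close>

section \<open>First-order calculus of the energy\<close>

lemma gradient_inner_nonneg_if_segment_min:
  fixes E :: "'a::euclidean_space \<Rightarrow> real"
  assumes "E differentiable (at x)"
    and min: "\<And>a. 0 \<le> a \<Longrightarrow> a \<le> 1 \<Longrightarrow> E x \<le> E (x + a *\<^sub>R d)"
  shows "0 \<le> gradient E x \<bullet> d"
proof (rule ccontr)
  assume neg: "\<not> 0 \<le> gradient E x \<bullet> d"
  have "(E has_derivative (\<lambda>h. h \<bullet> gradient E x)) (at (x + 0 *\<^sub>R d))"
    using GDERIV_gradient[OF assms(1)] by (simp add: gderiv_def)
  moreover have "((\<lambda>a. x + a *\<^sub>R d) has_derivative (\<lambda>a. a *\<^sub>R d)) (at 0)"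
    by (auto intro!: derivative_eq_intros)
  ultimately have "((\<lambda>a. E (x + a *\<^sub>R d)) has_derivative (\<lambda>a. (a *\<^sub>R d) \<bullet> gradient E x)) (at 0)"
    by (rule has_derivative_compose[rotated])
  then have "((\<lambda>a. E (x + a *\<^sub>R d)) has_real_derivative (gradient E x \<bullet> d)) (at 0)"
    unfolding has_field_derivative_def by (simp add: inner_commute mult.commute[of _ "gradient E x \<bullet> d"] mult_commute_abs)
  from DERIV_neg_dec_right[OF this] neg obtain e where
    e: "e > 0" "\<And>h. h > 0 \<Longrightarrow> h < e \<Longrightarrow> E (x + h *\<^sub>R d) < E x"
    by auto
  \<comment> \<open>Halving keeps \<open>h\<close> strictly inside the interval of decrease; the cap
    at 1 keeps it on the segment.\<close>
  define h where "h = min (e / 2) 1"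
  have "0 < h" "h < e" "h \<le> 1"
    using e(1) by (auto simp: h_def)
  with e(2)[of h] min[of h] show False by simp
qed

text \<open>\<open>gradient\<close> is a definite description, so continuity needs a formula: the
  product rule gives the derivative \<open>D x h\<close>, polynomial in \<open>x\<close> for fixed
  \<open>h\<close>, and uniqueness of derivatives turns every component of the gradient into such a
  polynomial.\<close>

lemma continuous_on_gradient_energy:
  fixes S :: "'n::finite \<Rightarrow> 'l::finite set"
  shows "continuous_on UNIV (gradient (energy S \<C> f))"
proof -
  define D where "D x h = (\<Sum>C\<in>\<C>. \<Sum>s\<in>listset (map S C). f C s *
      (\<Sum>j<length C. h $ (C ! j) $ (s ! j) *
        (\<Prod>k\<in>{..<length C} - {j}. x $ (C ! k) $ (s ! k))))" for x h :: "real ^ 'l ^ 'n"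
  have coord: "((\<lambda>x::real ^ 'l ^ 'n. x $ i $ s) has_derivative (\<lambda>h. h $ i $ s)) (at x)" for i s x
    by (intro bounded_linear.has_derivative[OF bounded_linear_vec_nth] has_derivative_ident)
  have "(energy S \<C> f has_derivative D x) (at x)" for x
    unfolding energy_def[abs_def] D_def[abs_def]
    by (intro has_derivative_sum has_derivative_mult_right has_derivative_prod coord)
  moreover have "(energy S \<C> f has_derivative (\<lambda>h. h \<bullet> gradient (energy S \<C> f) x)) (at x)" for x
    using GDERIV_gradient[OF energy_differentiable] by (simp add: gderiv_def)
  ultimately have "D x = (\<lambda>h. h \<bullet> gradient (energy S \<C> f) x)" for x
    by (blast intro: has_derivative_unique)
  then have "gradient (energy S \<C> f) x \<bullet> h = D x h" for x h
    by (simp add: inner_commute)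
  then show ?thesis
    by (subst continuous_on_componentwise) (auto simp: D_def intro!: continuous_intros)
qed

lemma continuous_on_energy:
  fixes S :: "'n::finite \<Rightarrow> 'l::finite set"
  shows "continuous_on UNIV (energy S \<C> f)"
  by (simp add: continuous_at_imp_continuous_on differentiable_imp_continuous_within
      energy_differentiable)

section \<open>Convexity and compactness of the feasible set\<close>

lemma convex_label_simplex: "convex (label_simplex L)"
  unfolding convex_def label_simplex_def
  by (auto simp: sum.distrib simp flip: sum_distrib_left)

lemma convex_feasible: "convex (feasible S)"
  by (auto intro!: convexI convexD[OF convex_label_simplex] simp: feasible_def)

lemma closed_feasible: "closed (feasible S)"
  unfolding feasible_def label_simplex_def Ball_def mem_Collect_eq
  by (intro closed_Collect_all closed_Collect_conj closed_Collect_imp open_Collect_const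
      closed_Collect_eq closed_Collect_le continuous_intros)

lemma bounded_feasible:
  fixes S :: "'n::finite \<Rightarrow> 'l::finite set"
  shows "bounded (feasible S)"
proof -
  have coord: "\<bar>v $ s\<bar> \<le> 1" if "v \<in> label_simplex L" for v :: "real ^ 'l" and L s
    using that member_le_sum[of s L "($) v"] by (cases "s \<in> L") (auto simp: label_simplex_def)
  have "norm x \<le> (\<Sum>i\<in>(UNIV::'n set). \<Sum>s\<in>(UNIV::'l set). 1)" if "x \<in> feasible S" for x
  proof -
    have "norm x \<le> (\<Sum>i\<in>UNIV. norm (x $ i))"
      unfolding norm_vec_def by (rule L2_set_le_sum) simp
    also have "\<dots> \<le> (\<Sum>i\<in>(UNIV::'n set). \<Sum>s\<in>(UNIV::'l set). 1)"
      using that coord unfolding feasible_def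
      by (intro sum_mono order_trans[OF norm_le_l1_cart]) blast
    finally show ?thesis .
  qed
  then show ?thesis
    unfolding bounded_iff by blast
qed

lemma compact_feasible:
  fixes S :: "'n::finite \<Rightarrow> 'l::finite set"
  shows "compact (feasible S)"
  by (simp add: compact_eq_bounded_closed bounded_feasible closed_feasible)

section \<open>Line search, Frank-Wolfe and projected gradient\<close>

lemma line_search_stepD:
  assumes "line_search_step E x s x'" "0 \<le> a" "a \<le> 1"
  shows "E x' \<le> E (x + a *\<^sub>R (s - x))"
  using assms unfolding line_search_step_def is_arg_min_def by (metis not_less)

lemma line_search_step_in_convex:
  assumes "line_search_step E x s x'" "convex X" "x \<in> X" "s \<in> X"
  shows "x' \<in> X"
proof -
  from assms(1) obtain a where "0 \<le> a" "a \<le> 1" and x': "x' = x + a *\<^sub>R (s - x)"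
    unfolding line_search_step_def is_arg_min_def by blast
  with assms have "(1 - a) *\<^sub>R x + a *\<^sub>R s \<in> X"
    by (intro convexD) auto
  moreover have "(1 - a) *\<^sub>R x + a *\<^sub>R s = x'"
    by (simp add: x' algebra_simps)
  ultimately show ?thesis by simp
qed

text \<open>Common core of both line-search methods, for arbitrary targets in \<open>X\<close>.
  Compactness supplies a further subsequence along which the targets converge too; what the choice
  of targets says about \<open>t\<close> is left to each method.\<close>

lemma line_search_limit_direction:
  fixes E :: "'a::euclidean_space \<Rightarrow> real"
  assumes "compact X" "convex X"
    and diff: "\<And>y. E differentiable (at y)"
    and "x 0 \<in> X" and s: "\<And>k. s k \<in> X"
    and step: "\<And>k. line_search_step E (x k) (s k) (x (Suc k))"
    and r: "strict_mono r" "(x \<circ> r) \<longlonglongrightarrow> y"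
  obtains q t where "strict_mono q" "y \<in> X" "t \<in> X" "(x \<circ> q) \<longlonglongrightarrow> y" "(s \<circ> q) \<longlonglongrightarrow> t"
    "0 \<le> gradient E y \<bullet> (t - y)"
proof -
  have x: "x k \<in> X" for k
    by (induction k) (use assms line_search_step_in_convex in blast)+
  have y: "y \<in> X"
    using closed_sequentially[OF compact_imp_closed[OF \<open>compact X\<close>] _ r(2)] x by simp
  obtain t r' where t: "t \<in> X" "strict_mono r'" "(s \<circ> r \<circ> r') \<longlonglongrightarrow> t"
    using \<open>compact X\<close> s unfolding compact_def by (metis comp_apply)
  define q where "q = r \<circ> r'"
  have q: "strict_mono q"
    unfolding q_def using r(1) t(2) by (rule strict_mono_o)
  have xq: "(x \<circ> q) \<longlonglongrightarrow> y"
    unfolding q_def using LIMSEQ_subseq_LIMSEQ[OF r(2) t(2)] by (simp add: o_assoc)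
  have sq: "(s \<circ> q) \<longlonglongrightarrow> t"
    unfolding q_def using t(3) by (simp add: o_assoc)
  have cont: "isCont E z" for z
    by (rule differentiable_imp_continuous_within) (rule diff)
  \<comment> \<open>The step size 0 is admissible, so a line search never increases
    \<open>E\<close>.\<close>
  have dec: "decseq (\<lambda>k. E (x k))"
    using line_search_stepD[OF step, of 0] by (simp add: decseq_Suc_iff)
  have Exq: "(\<lambda>k. E (x (q k))) \<longlonglongrightarrow> E y"
    using isCont_tendsto_compose[OF cont xq] by (simp add: o_def)
  have ge: "E y \<le> E (x k)" for k
  proof (rule LIMSEQ_le_const2[OF Exq], intro exI allI impI)
    fix n assume "k \<le> n"
    then show "E (x (q n)) \<le> E (x k)"
      using decseqD[OF dec] seq_suble[OF q, of n] by (meson order_trans)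
  qed
  have "0 \<le> gradient E y \<bullet> (t - y)"
  proof (rule gradient_inner_nonneg_if_segment_min[OF diff])
    fix a :: real assume a: "0 \<le> a" "a \<le> 1"
    have "(\<lambda>k. x (q k) + a *\<^sub>R (s (q k) - x (q k))) \<longlonglongrightarrow> y + a *\<^sub>R (t - y)"
      using xq sq unfolding o_def by (intro tendsto_intros)
    then have "(\<lambda>k. E (x (q k) + a *\<^sub>R (s (q k) - x (q k)))) \<longlonglongrightarrow> E (y + a *\<^sub>R (t - y))"
      by (rule isCont_tendsto_compose[OF cont])
    \<comment> \<open>Before the limit, \<open>E y\<close> is at most the energy at
      \<open>x (Suc (q k))\<close>, and exact line search puts that below the value for the fixed
      step size \<open>a\<close>.\<close>
    then show "E y \<le> E (y + a *\<^sub>R (t - y))"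
      by (rule LIMSEQ_le_const) (use ge line_search_stepD[OF step a] order_trans in blast)
  qed
  with that q y t(1) xq sq show ?thesis by blast
qed

lemma fw_limit_point_stationary:
  fixes E :: "'a::euclidean_space \<Rightarrow> real"
  assumes "compact X" "convex X"
    and diff: "\<And>y. E differentiable (at y)"
    and cont: "continuous_on UNIV (gradient E)"
    and "fw_sequence E X x" "strict_mono r" "(x \<circ> r) \<longlonglongrightarrow> y"
  shows "stationary_point E X y"
proof -
  from \<open>fw_sequence E X x\<close> obtain s where x0: "x 0 \<in> X"
    and s: "\<And>k. is_arg_min (\<lambda>z. z \<bullet> gradient E (x k)) (\<lambda>z. z \<in> X) (s k)"
    and step: "\<And>k. line_search_step E (x k) (s k) (x (Suc k))"
    unfolding fw_sequence_def by metis
  have sX: "s k \<in> X" and smin: "z \<in> X \<Longrightarrow> s k \<bullet> gradient E (x k) \<le> z \<bullet> gradient E (x k)" for k z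
    using s[of k] unfolding is_arg_min_def by (auto simp: not_less)
  obtain q t where q: "y \<in> X" "t \<in> X" "(x \<circ> q) \<longlonglongrightarrow> y" "(s \<circ> q) \<longlonglongrightarrow> t"
    and nonneg: "0 \<le> gradient E y \<bullet> (t - y)"
    using line_search_limit_direction[where E = E and x = x and s = s and X = X and y = y and r = r]
      assms x0 sX step by metis
  have g: "(\<lambda>k. gradient E (x (q k))) \<longlonglongrightarrow> gradient E y"
    using continuous_on_tendsto_compose[OF cont q(3)] by simp
  \<comment> \<open>Optimality of the targets passes to the limit; hence every direction
    \<open>z - y\<close> has slope at least that of \<open>t - y\<close>.\<close>
  have "t \<bullet> gradient E y \<le> z \<bullet> gradient E y" if "z \<in> X" for z
  proof (rule LIMSEQ_le)
    show "(\<lambda>k. s (q k) \<bullet> gradient E (x (q k))) \<longlonglongrightarrow> t \<bullet> gradient E y"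
      using q(4) g unfolding o_def by (intro tendsto_intros)
    show "(\<lambda>k. z \<bullet> gradient E (x (q k))) \<longlonglongrightarrow> z \<bullet> gradient E y"
      using g by (intro tendsto_intros)
  qed (use smin that in blast)
  with q(1) nonneg show ?thesis
    unfolding stationary_point_def by (fastforce simp: inner_diff_right inner_commute)
qed

lemma pgd_limit_point_stationary:
  fixes E :: "'a::euclidean_space \<Rightarrow> real"
  assumes "compact X" "convex X"
    and diff: "\<And>y. E differentiable (at y)"
    and cont: "continuous_on UNIV (gradient E)"
    and "pgd_sequence (\<lambda>k. 1) E X x" "strict_mono r" "(x \<circ> r) \<longlonglongrightarrow> y"
  shows "stationary_point E X y"
proof -
  from \<open>pgd_sequence (\<lambda>k. 1) E X x\<close> obtain s where x0: "x 0 \<in> X"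
    and s: "\<And>k. is_arg_min (\<lambda>z. (norm (x k - gradient E (x k) - z))\<^sup>2) (\<lambda>z. z \<in> X) (s k)"
    and step: "\<And>k. line_search_step E (x k) (s k) (x (Suc k))"
    unfolding pgd_sequence_def scaleR_one by metis
  have sX: "s k \<in> X"
    and smin: "z \<in> X \<Longrightarrow> dist (x k - gradient E (x k)) (s k) \<le> dist (x k - gradient E (x k)) z"
    for k z
    using s[of k] unfolding is_arg_min_def dist_norm
    by (auto simp: not_less dest!: spec[of _ z] power2_le_imp_le)
  obtain q t where q: "y \<in> X" "t \<in> X" "(x \<circ> q) \<longlonglongrightarrow> y" "(s \<circ> q) \<longlonglongrightarrow> t"
    and nonneg: "0 \<le> gradient E y \<bullet> (t - y)"
    using line_search_limit_direction[where E = E and x = x and s = s and X = X and y = y and r = r]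
      assms x0 sX step by metis
  have g: "(\<lambda>k. gradient E (x (q k))) \<longlonglongrightarrow> gradient E y"
    using continuous_on_tendsto_compose[OF cont q(3)] by simp
  \<comment> \<open>In the limit, \<open>t\<close> is the projection of
    \<open>y - gradient E y\<close> onto \<open>X\<close>.\<close>
  have "dist (y - gradient E y) t \<le> dist (y - gradient E y) z" if "z \<in> X" for z
  proof (rule LIMSEQ_le)
    show "(\<lambda>k. dist (x (q k) - gradient E (x (q k))) (s (q k))) \<longlonglongrightarrow> dist (y - gradient E y) t"
      using q(3,4) g unfolding o_def by (intro tendsto_intros)
    show "(\<lambda>k. dist (x (q k) - gradient E (x (q k))) z) \<longlonglongrightarrow> dist (y - gradient E y) z"
      using q(3) g unfolding o_def by (intro tendsto_intros)
  qed (use smin that in blast)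
  then have proj: "(y - gradient E y - t) \<bullet> (z - t) \<le> 0" if "z \<in> X" for z
    using any_closest_point_dot[OF \<open>convex X\<close> compact_imp_closed[OF \<open>compact X\<close>] q(2) that] by blast
  \<comment> \<open>The projection inequality at \<open>z = y\<close> bounds the squared distance by
    \<open>- (gradient E y \<bullet> (t - y))\<close>. Once \<open>t = y\<close>, the same
    inequality for general \<open>z\<close> is stationarity.\<close>
  have "(y - t) \<bullet> (y - t) \<le> 0"
    using proj[OF q(1)] nonneg by (simp add: inner_diff_left inner_diff_right inner_commute)
  then have "t = y"
    using inner_ge_zero[of "y - t"] by (simp add: antisym)
  with proj q(1) show ?thesis
    unfolding stationary_point_def by simp
qed

section \<open>Block coordinate descent\<close>

lemma bcd_sweep_block:
  fixes x x' :: "real ^ 'l::finite ^ 'n::{finite,linorder}"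
  assumes "bcd_sweep S E x x'"
  defines "y \<equiv> \<lambda>i. \<chi> j. if j < i then x' $ j else x $ j"
  shows "discrete_block_solution S E (y i) i (x' $ i)"
    and "discrete_block_solution S E (y i) i (x $ i) \<Longrightarrow> x' $ i = x $ i"
  using assms unfolding bcd_sweep_def Let_def by (metis (no_types, lifting))+

lemma bcd_sweep_discrete:
  assumes "bcd_sweep S E x x'"
  shows "x' \<in> feasible S" "x' $ i $ s \<in> {0, 1}"
  using bcd_sweep_block(1)[OF assms]
  unfolding feasible_def discrete_block_solution_def is_arg_min_def by blast+

text \<open>The blocks are replaced one at a time. The rule that keeps an already optimal discrete
  block makes every actual change strictly profitable, which rules out cycling among points of equal
  energy.\<close>

lemma bcd_sweep_decreases:
  fixes x x' :: "real ^ 'l::finite ^ 'n::{finite,linorder}"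
  assumes sweep: "bcd_sweep S E x x'"
    and feas: "x \<in> feasible S" and disc: "\<And>i s. x $ i $ s \<in> {0, 1}" and "x' \<noteq> x"
  shows "E x' < E x"
proof -
  define m where "m A = (\<chi> j. if j \<in> A then x' $ j else x $ j)" for A
  \<comment> \<open>For an initial segment \<open>A\<close> of the nodes, \<open>m A\<close> is
    exactly the vector that the sweep sees at the next node.\<close>
  have "(\<forall>a\<in>A. \<forall>b<a. b \<in> A) \<Longrightarrow> m A = x \<or> E (m A) < E x" for A :: "'n set"
    using finite[of A]
  proof (induction A rule: finite_linorder_max_induct)
    case empty
    then show ?case by (simp add: m_def vec_eq_iff)
  next
    case (insert b A)
    have A: "A = {..<b}"
      using insert by auto
    then have IH: "m A = x \<or> E (m A) < E x"
      using insert.IH by (metis lessThan_iff order_less_trans)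
    have mA: "m A = (\<chi> j. if j < b then x' $ j else x $ j)"
      by (simp add: m_def A)
    have old: "set_block (m A) b (x $ b) = m A"
      and new: "set_block (m A) b (x' $ b) = m (insert b A)"
      unfolding mA by (auto simp: m_def A set_block_def vec_eq_iff)
    note block = bcd_sweep_block[OF sweep, of b, folded mA]
    show ?case
    proof (cases "x' $ b = x $ b")
      case True
      with old new IH show ?thesis by simp
    next
      case False
      \<comment> \<open>The old block is feasible and discrete, so it can only fail by not being a
        minimizer.\<close>
      with block(2) have "\<not> discrete_block_solution S E (m A) b (x $ b)"
        by blast
      then obtain w where w: "w \<in> label_simplex (S b)" "E (set_block (m A) b w) < E (m A)"
        using feas disc old unfolding discrete_block_solution_def is_arg_min_def feasible_def by auto
      have "E (m (insert b A)) \<le> E (set_block (m A) b w)"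
        using block(1) w(1) new unfolding discrete_block_solution_def is_arg_min_def
        by (auto simp: not_less)
      with w(2) IH show ?thesis by auto
    qed
  qed
  from this[of UNIV] \<open>x' \<noteq> x\<close> show ?thesis
    by (simp add: m_def)
qed

lemma finite_discrete_points:
  "finite {x :: real ^ 'l::finite ^ 'n::finite. \<forall>i s. x $ i $ s \<in> {0, 1}}"
proof (rule finite_surj[of "UNIV :: ('n \<Rightarrow> 'l \<Rightarrow> bool) set"])
  show "{x :: real ^ 'l ^ 'n. \<forall>i s. x $ i $ s \<in> {0, 1}} \<subseteq> (\<lambda>g. \<chi> i s. of_bool (g i s)) ` UNIV"
  proof
    fix x :: "real ^ 'l ^ 'n" assume "x \<in> {x. \<forall>i s. x $ i $ s \<in> {0, 1}}"
    then have "x = (\<chi> i s. of_bool (x $ i $ s = 1))"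
      by (auto simp: vec_eq_iff)
    then show "x \<in> (\<lambda>g. \<chi> i s. of_bool (g i s)) ` UNIV"
      by (rule image_eqI[where x = "\<lambda>i s. x $ i $ s = 1"]) simp
  qed
qed simp

lemma bcd_sequence_eventually_constant:
  fixes x :: "nat \<Rightarrow> real ^ 'l::finite ^ 'n::{finite,linorder}"
  assumes "bcd_sequence S E x"
  obtains K where "bcd_sweep S E (x K) (x K)" "\<And>k. K \<le> k \<Longrightarrow> x k = x K"
proof -
  have "\<exists>k. x (Suc k) = x k"
  proof (rule ccontr)
    assume "\<nexists>k. x (Suc k) = x k"
    then have change: "x (Suc k) \<noteq> x k" for k by blast
    with assms have sweep: "bcd_sweep S E (x k) (x (Suc k))" for k
      unfolding bcd_sequence_def by metis
    \<comment> \<open>Shifted by one because \<open>x 0\<close> need not be discrete. Strict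
      decrease makes the iterates distinct, against the finiteness of the discrete points.\<close>
    have "E (x (Suc (Suc k))) < E (x (Suc k))" for k
      using bcd_sweep_decreases[OF sweep bcd_sweep_discrete[OF sweep] change] .
    then have "strict_mono (\<lambda>k. - E (x (Suc k)))"
      by (simp add: strict_mono_Suc_iff)
    then have "inj (\<lambda>k. x (Suc k))"
      by (metis (mono_tags, lifting) injI strict_mono_eq)
    moreover have "range (\<lambda>k. x (Suc k)) \<subseteq> {x. \<forall>i s. x $ i $ s \<in> {0, 1}}"
      using bcd_sweep_discrete(2)[OF sweep] by blast
    ultimately show False
      using finite_discrete_points finite_subset range_inj_infinite by blast
  qed
  \<comment> \<open>The least such index: the step from \<open>K\<close> is still a genuine sweep,
    and all later steps fall under the stopping rule.\<close>
  then obtain K where K: "x (Suc K) = x K" "\<And>j. j < K \<Longrightarrow> x (Suc j) \<noteq> x j"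
    using exists_least_iff[of "\<lambda>k. x (Suc k) = x k"] by blast
  then have "bcd_sweep S E (x K) (x K)"
    using assms unfolding bcd_sequence_def by metis
  moreover have "x k = x K" if "K \<le> k" for k
    using that
  proof (induction k rule: dec_induct)
    case (step k)
    then have "x (Suc k) = x k"
      using assms K(1) unfolding bcd_sequence_def by (metis le_neq_implies_less)
    with step.IH show ?case by simp
  qed simp
  ultimately show ?thesis
    using that by blast
qed

lemma blockwise_min_imp_stationary:
  fixes E :: "real ^ 'l::finite ^ 'n::finite \<Rightarrow> real"
  assumes diff: "E differentiable (at x)" and feas: "x \<in> feasible S"
    and min: "\<And>i v. v \<in> label_simplex (S i) \<Longrightarrow> E x \<le> E (set_block x i v)"
  shows "stationary_point E (feasible S) x"
  unfolding stationary_point_def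
proof (intro conjI ballI feas)
  fix z assume z: "z \<in> feasible S"
  have block: "0 \<le> gradient E x \<bullet> axis i (z $ i - x $ i)" for i
  proof (rule gradient_inner_nonneg_if_segment_min[OF diff])
    fix a :: real assume a: "0 \<le> a" "a \<le> 1"
    have "(1 - a) *\<^sub>R x $ i + a *\<^sub>R z $ i \<in> label_simplex (S i)"
      using z feas a unfolding feasible_def by (intro convexD[OF convex_label_simplex]) auto
    moreover have "x + a *\<^sub>R axis i (z $ i - x $ i) = set_block x i ((1 - a) *\<^sub>R x $ i + a *\<^sub>R z $ i)"
      by (auto simp: set_block_def axis_def vec_eq_iff algebra_simps)
    ultimately show "E x \<le> E (x + a *\<^sub>R axis i (z $ i - x $ i))"
      using min by simp
  qed
  \<comment> \<open>Since the feasible set is a product, each summand is a feasible direction by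
    itself.\<close>
  have "z - x = (\<Sum>i\<in>UNIV. axis i (z $ i - x $ i))"
    by (simp add: vec_eq_iff axis_def sum.delta)
  then have "gradient E x \<bullet> (z - x) = (\<Sum>i\<in>UNIV. gradient E x \<bullet> axis i (z $ i - x $ i))"
    by (simp add: inner_sum_right)
  also have "\<dots> \<ge> 0"
    using block by (simp add: sum_nonneg)
  finally show "0 \<le> gradient E x \<bullet> (z - x)" .
qed

lemma bcd_limit_point_stationary:
  fixes x :: "nat \<Rightarrow> real ^ 'l::finite ^ 'n::{finite,linorder}"
  assumes diff: "\<And>y. E differentiable (at y)"
    and "bcd_sequence S E x" and r: "strict_mono r" "(x \<circ> r) \<longlonglongrightarrow> y"
  shows "stationary_point E (feasible S) y"
proof -
  obtain K where sweep: "bcd_sweep S E (x K) (x K)" and const: "\<And>k. K \<le> k \<Longrightarrow> x k = x K"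
    using bcd_sequence_eventually_constant[OF assms(2)] by blast
  have "\<forall>\<^sub>F k in sequentially. (x \<circ> r) k = x K"
    unfolding eventually_sequentially comp_apply
    using const seq_suble[OF r(1)] order_trans by blast
  then have y: "y = x K"
    using r(2) tendsto_eventually LIMSEQ_unique by blast
  \<comment> \<open>In a sweep from \<open>x K\<close> to itself, the mixture of old and new blocks
    is \<open>x K\<close> at every node.\<close>
  have "is_arg_min (\<lambda>w. E (set_block (x K) i w)) (\<lambda>w. w \<in> label_simplex (S i)) (x K $ i)" for i
    using bcd_sweep_block(1)[OF sweep, of i] by (simp add: discrete_block_solution_def)
  moreover have "set_block (x K) i (x K $ i) = x K" for i
    by (simp add: set_block_def vec_eq_iff)
  ultimately show ?thesis
    unfolding y
    by (intro blockwise_min_imp_stationary[OF diff])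
       (auto simp: feasible_def is_arg_min_def not_less)
qed

theorem proposition2:
  fixes S :: "('n::{finite,linorder}) \<Rightarrow> ('l::finite) set"
    and \<C> :: "'n list set"
    and f :: "'n list \<Rightarrow> 'l list \<Rightarrow> real"
    and x :: "nat \<Rightarrow> real ^ ('l::finite) ^ ('n::{finite,linorder})"
    and xstar :: "real ^ ('l::finite) ^ ('n::{finite,linorder})"
    and r :: "nat \<Rightarrow> nat"
  assumes "\<And>i. S i \<noteq> {}"
    and "finite \<C>"
    and "\<And>C. C \<in> \<C> \<Longrightarrow> C \<noteq> [] \<and> distinct C"
    and "\<And>i. [i] \<in> \<C>"
    and "bcd_sequence S (energy S \<C> f) x \<or>
         pgd_sequence (\<lambda>k. 1) (energy S \<C> f) (feasible S) x \<or>
         fw_sequence (energy S \<C> f) (feasible S) x"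
    and "strict_mono r"
    and "(x \<circ> r) \<longlonglongrightarrow> xstar"
  shows "stationary_point (energy S \<C> f) (feasible S) xstar"
  using assms(5)
  by (elim disjE)
     (rule bcd_limit_point_stationary[OF energy_differentiable _ assms(6,7)]
        pgd_limit_point_stationary[OF compact_feasible convex_feasible energy_differentiable
          continuous_on_gradient_energy _ assms(6,7)]
        fw_limit_point_stationary[OF compact_feasible convex_feasible energy_differentiable
          continuous_on_gradient_energy _ assms(6,7)], assumption)+

end
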